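(* Let $N\ge2$ and let $k_p\in\{0,2\}$. Consider a configuration of vortices on the unit sphere formed of a latitudinal regular $N$-gon of vortices of vorticity $+1$ and a latitudinal regular $N$-gon of vortices of vorticity $-1$, the two rings lying on opposite latitudes (co-latitudes $\theta$ and $\pi-\theta$, $0<\theta<\pi$), together with, if $k_p=2$, two polar vortices of opposite vorticities ($\lambda_n$ at the North pole and $\lambda_s=-\lambda_n$ at the South pole). Assume that either - the two rings are in phase (same longitudes, and then $\theta\ne\pi/2$): configuration $D_{Nh}(2R,k_pp)$; or - the two rings are out of phase with an offset equal to $\pi/N$: configuration $D_{Nd}(R,R',k_pp)$. Then the configuration is a relative equilibrium.
   Context: Vortices $x_1,\dots,x_M$ on the unit sphere $S^2\subset\mathbb{R}^3$ with vorticities $\lambda_1,\dots,\lambda_M$ (polar vortices included, $M=2N+k_p$); phase space $\mathcal{P}=\{(x_1,\dots,x_M)\in (S^2)^M: x_i\ne x_j \text{ if } i\ne j\}$. Equations of motion: $\dot x_i=\sum_{j\ne i}\lambda_j\,\frac{x_j\times x_i}{1-x_i\cdot x_j}$. $SO(3)$ acts diagonally on $\mathcal{P}$. A point $x_e\in\mathcal{P}$ is a relative equilibrium if for every $t$ there is $g_t\in SO(3)$ such that the solution with $x_e(0)=x_e$ satisfies $x_e(t)=g_t\cdot x_e$. The strength $\lambda_n$ of the polar vortices is not assumed to coincide with that of the ring vortices. *)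

theory Defs
  imports "HOL-Analysis.Analysis"
begin

text \<open>
  A configuration of M vortices is a function x with x i in real^3 the position of the i-th
  vortex, for i < M; values at indices i \<ge> M are irrelevant everywhere below.
\<close>

definition phase_space :: "nat \<Rightarrow> (nat \<Rightarrow> real^3) set" where
  "phase_space M = {x. (\<forall>i<M. x i \<in> sphere 0 1) \<and> (\<forall>i<M. \<forall>j<M. i \<noteq> j \<longrightarrow> x i \<noteq> x j)}"

definition vortex_field :: "nat \<Rightarrow> (nat \<Rightarrow> real) \<Rightarrow> (nat \<Rightarrow> real^3) \<Rightarrow> nat \<Rightarrow> real^3" where
  "vortex_field M lam x i =
     (\<Sum>j \<in> {..<M} - {i}. (lam j / (1 - x i \<bullet> x j)) *\<^sub>R cross3 (x j) (x i))"

definition vortex_solution_on ::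
    "real set \<Rightarrow> nat \<Rightarrow> (nat \<Rightarrow> real) \<Rightarrow> (real \<Rightarrow> nat \<Rightarrow> real^3) \<Rightarrow> bool" where
  "vortex_solution_on J M lam X \<longleftrightarrow>
     (\<forall>t\<in>J. X t \<in> phase_space M \<and>
        (\<forall>i<M. ((\<lambda>s. X s i) has_vector_derivative vortex_field M lam (X t) i) (at t within J)))"

text \<open>
  ``The solution through xe'' is rendered without presupposing well-posedness of the equations:
  a solution through xe exists for all times, and every solution through xe, on whatever open
  interval around 0 it is defined, stays in the orbit of xe under the diagonal action of SO(3)
  (the group of matrices satisfying \<^const>\<open>rotation_matrix\<close>).
\<close>

definition relative_equilibrium :: "nat \<Rightarrow> (nat \<Rightarrow> real) \<Rightarrow> (nat \<Rightarrow> real^3) \<Rightarrow> bool" where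
  "relative_equilibrium M lam xe \<longleftrightarrow>
     xe \<in> phase_space M \<and>
     (\<exists>X. vortex_solution_on UNIV M lam X \<and> (\<forall>i<M. X 0 i = xe i)) \<and>
     (\<forall>J X. open J \<and> is_interval J \<and> 0 \<in> J \<and> vortex_solution_on J M lam X \<and>
            (\<forall>i<M. X 0 i = xe i) \<longrightarrow>
        (\<forall>t\<in>J. \<exists>g :: real^3^3. rotation_matrix g \<and> (\<forall>i<M. X t i = g *v xe i)))"

definition sphere_point :: "real \<Rightarrow> real \<Rightarrow> real^3" where
  "sphere_point \<theta> \<phi> = vector [sin \<theta> * cos \<phi>, sin \<theta> * sin \<phi>, cos \<theta>]"

definition latitudinal_ngon :: "nat \<Rightarrow> real \<Rightarrow> real \<Rightarrow> nat \<Rightarrow> real^3" where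
  "latitudinal_ngon N \<theta> \<phi> k = sphere_point \<theta> (\<phi> + 2 * pi * real k / real N)"

text \<open>
  Labelling: indices 0, ..., N-1 are the ring of vorticity +1 (co-latitude \<theta>), N, ..., 2N-1 the
  ring of vorticity -1 (co-latitude pi - \<theta>, longitudes shifted by \<delta>), 2N the North pole and
  2N+1 the South pole.  With M = 2N the poles are absent, with M = 2N+2 they are present.
\<close>

definition two_ring_config :: "nat \<Rightarrow> real \<Rightarrow> real \<Rightarrow> real \<Rightarrow> nat \<Rightarrow> real^3" where
  "two_ring_config N \<theta> \<phi> \<delta> i =
     (if i < N then latitudinal_ngon N \<theta> \<phi> i
      else if i < 2 * N then latitudinal_ngon N (pi - \<theta>) (\<phi> + \<delta>) (i - N)
      else if i = 2 * N then vector [0, 0, 1]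
      else vector [0, 0, -1])"

definition two_ring_vorticity :: "nat \<Rightarrow> real \<Rightarrow> real \<Rightarrow> nat \<Rightarrow> real" where
  "two_ring_vorticity N lam_n lam_s i =
     (if i < N then 1
      else if i < 2 * N then -1
      else if i = 2 * N then lam_n
      else lam_s)"

end

theory Submission
  imports Defs
begin

text \<open>
  The theorem is a symmetry argument. Write \<open>e\<^sub>3\<close> for the unit vector along the polar axis. The
  vortex field is equivariant under orthogonal maps up to the determinant
  (\<open>interaction_orthogonal\<close>), and reversing all vorticities reverses it. The configuration has
  three kinds of symmetry, described in \<open>two_ring_field_symmetries\<close>:

  \<^item> rotations about the axis by multiples of \<open>2 \<pi> / N\<close>, which commute with the field;
  \<^item> the reflection in the meridian plane of a vertex, which preserves vorticities and reverses
    the field;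
  \<^item> a rotatory reflection by the offset \<open>\<delta>\<close>, which exchanges the rings and the poles. It reverses
    both the orientation and all vorticities, so it commutes with the field.

  The second symmetry makes the velocity of the vertex tangential to its parallel, hence equal to
  \<open>\<omega> e\<^sub>3 \<times> q\<close> at the position \<open>q\<close> of the vertex for some \<open>\<omega>\<close>. The other two propagate this with the same
  \<open>\<omega>\<close> to all vertices of both rings (\<open>two_ring_field_rigid\<close>), and at the poles the symmetries
  leave only the velocity \<open>0\<close> (\<open>two_ring_field_poles\<close>). The polar vortices take part in the
  third symmetry because their strengths are opposite.

  So all vortices start with the velocities of one infinitesimal rotation, and by equivariance the
  uniformly rotating configuration solves the equations. That any solution through the
  configuration is this one needs uniqueness, \<open>vortex_solution_unique\<close>, which is proved from a
  Lipschitz bound away from collisions and Gronwall's inequality. The two arguments meet in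
  \<open>relative_equilibrium_if_rigid_field\<close>.
\<close>

section \<open>Pairwise interaction of vortices\<close>

text \<open>
  At \<^term>\<open>p = q\<close> the coefficient is a division by zero and the cross product vanishes, so
  the diagonal term contributes \<^term>\<open>0\<close>. Sums over the other vortices may therefore be taken
  over all of them, which makes the velocity a function of the position alone.
\<close>
definition interaction :: "real^3 \<Rightarrow> real^3 \<Rightarrow> real^3" where
  "interaction p q = (1 / (1 - q \<bullet> p)) *\<^sub>R cross3 p q"

lemma interaction_self [simp]: "interaction q q = 0"
  by (simp add: interaction_def)

lemma vortex_field_eq_sum:
  assumes "i < M"
  shows "vortex_field M lam x i = (\<Sum>j<M. lam j *\<^sub>R interaction (x j) (x i))"
proof -
  have "(\<Sum>j<M. lam j *\<^sub>R interaction (x j) (x i))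
        = (\<Sum>j\<in>{..<M} - {i}. lam j *\<^sub>R interaction (x j) (x i))"
    using assms by (subst sum.remove [of _ i]) auto
  then show ?thesis
    by (simp add: vortex_field_def interaction_def)
qed

text \<open>
  Inner products are preserved and the cross product is a pseudovector: improper maps reverse
  the induced velocity.
\<close>
lemma interaction_orthogonal:
  assumes "orthogonal_matrix A"
  shows "interaction (A *v p) (A *v q) = det A *\<^sub>R (A *v interaction p q)"
proof -
  have "(A *v q) \<bullet> (A *v p) = q \<bullet> p"
    using assms orthogonal_transformation_def orthogonal_transformation_matrix
    by (metis matrix_of_matrix_vector_mul matrix_vector_mul_linear)
  then show ?thesis
    by (simp add: interaction_def cross_orthogonal_matrix[OF assms] matrix_vector_mult_scaleR
        scaleR_left_commute mult.commute)
qed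

lemma norm_cross3_le: "norm (cross3 x y) \<le> norm x * norm y"
proof -
  have "(norm (cross3 x y))\<^sup>2 \<le> (norm x * norm y)\<^sup>2"
    by (simp add: norm_cross power_mult_distrib)
  then show ?thesis
    by (rule power2_le_imp_le) simp
qed

text \<open>
  Away from collisions the interaction is Lipschitz: the numerator is bilinear in unit vectors,
  and the denominators stay above \<^term>\<open>c\<close>. This is the estimate behind uniqueness of
  solutions.
\<close>
lemma interaction_lipschitz:
  assumes unit: "norm p = 1" "norm q = 1" "norm p' = 1" "norm q' = 1"
    and c: "0 < c" "c \<le> 1 - q \<bullet> p" "c \<le> 1 - q' \<bullet> p'"
  shows "norm (interaction p q - interaction p' q')
         \<le> (1 / c + 1 / c\<^sup>2) * (norm (p - p') + norm (q - q'))"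
proof -
  define d where "d = norm (p - p') + norm (q - q')"
  define r r' where "r = 1 - q \<bullet> p" and "r' = 1 - q' \<bullet> p'"
  have r: "0 < r" "0 < r'" "c \<le> r" "c \<le> r'" using c by (auto simp: r_def r'_def)
  have "cross3 p q - cross3 p' q' = cross3 (p - p') q + cross3 p' (q - q')"
    by (simp add: Cross3.left_diff_distrib Cross3.right_diff_distrib)
  then have num: "norm (cross3 p q - cross3 p' q') \<le> d"
    using norm_triangle_le norm_cross3_le[of "p - p'" q] norm_cross3_le[of p' "q - q'"] unit
    by (smt (verit) d_def mult_cancel_left1 mult_cancel_right1 norm_triangle_ineq)
  have "r' - r = (q - q') \<bullet> p + q' \<bullet> (p - p')"
    by (simp add: r_def r'_def inner_diff_left inner_diff_right)
  then have den: "\<bar>r' - r\<bar> \<le> d"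
    using Cauchy_Schwarz_ineq2[of "q - q'" p] Cauchy_Schwarz_ineq2[of q' "p - p'"] unit
    by (simp add: d_def)
  have cr: "norm (cross3 p' q') \<le> 1"
    using norm_cross3_le[of p' q'] unit by simp
  \<comment> \<open>The quotient rule for differences: vary the numerator first, then the denominator.\<close>
  have split: "interaction p q - interaction p' q'
      = (1 / r) *\<^sub>R (cross3 p q - cross3 p' q') + ((r' - r) / (r * r')) *\<^sub>R cross3 p' q'"
    using r by (simp add: interaction_def r_def[symmetric] r'_def[symmetric] scaleR_diff_right
        diff_divide_distrib scaleR_diff_left)
  have "norm ((1 / r) *\<^sub>R (cross3 p q - cross3 p' q')) \<le> (1 / c) * d"
    using r c num frac_le[of d "norm (cross3 p q - cross3 p' q')" c r] norm_ge_zero order_trans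
    by (fastforce simp: d_def)
  moreover have "norm (((r' - r) / (r * r')) *\<^sub>R cross3 p' q') \<le> (1 / c\<^sup>2) * d"
  proof -
    have "\<bar>r' - r\<bar> / (r * r') \<le> d / c\<^sup>2"
      using r c den by (intro frac_le) (auto simp: power2_eq_square intro!: mult_mono)
    then have "\<bar>r' - r\<bar> / (r * r') * norm (cross3 p' q') \<le> d / c\<^sup>2 * 1"
      using cr r by (intro mult_mono) (auto simp: d_def)
    then show ?thesis using r by (simp add: abs_mult)
  qed
  ultimately show ?thesis
    unfolding split d_def[symmetric] by (simp add: distrib_right norm_triangle_le)
qed

section \<open>Uniqueness of solutions\<close>

text \<open>
  The bound on the derivative makes \<^term>\<open>D s * exp (- L * s)\<close> nonincreasing and
  \<^term>\<open>D s * exp (L * s)\<close> nondecreasing. Both vanish at \<^term>\<open>0::real\<close>; the first bounds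
  \<^term>\<open>D t\<close> by \<^term>\<open>0::real\<close> for positive \<^term>\<open>t\<close>, the second for negative \<^term>\<open>t\<close>.
\<close>
lemma gronwall_zero:
  fixes D D' :: "real \<Rightarrow> real"
  assumes deriv: "\<And>s. s \<in> closed_segment 0 t \<Longrightarrow> (D has_real_derivative D' s) (at s)"
    and bound: "\<And>s. s \<in> closed_segment 0 t \<Longrightarrow> \<bar>D' s\<bar> \<le> L * D s"
    and "D 0 = 0" "0 \<le> D t"
  shows "D t = 0"
proof (cases "0 \<le> t")
  case True
  have "D t * exp (- L * t) \<le> D 0 * exp (- L * 0)"
  proof (rule DERIV_nonpos_imp_nonincreasing[OF True])
    fix s assume "0 \<le> s" "s \<le> t"
    then have s: "s \<in> closed_segment 0 t" by (simp add: closed_segment_eq_real_ivl)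
    have "((\<lambda>s. D s * exp (- L * s)) has_real_derivative (D' s - L * D s) * exp (- L * s)) (at s)"
      by (rule derivative_eq_intros deriv[OF s] refl | simp add: algebra_simps)+
    moreover have "(D' s - L * D s) * exp (- L * s) \<le> 0"
      using bound[OF s] by (intro mult_nonpos_nonneg) auto
    ultimately show "\<exists>y. ((\<lambda>s. D s * exp (- L * s)) has_real_derivative y) (at s) \<and> y \<le> 0"
      by blast
  qed
  with assms(3,4) show ?thesis by (simp add: mult_le_0_iff)
next
  case False
  then have t: "t \<le> 0" by simp
  have "D t * exp (L * t) \<le> D 0 * exp (L * 0)"
  proof (rule DERIV_nonneg_imp_nondecreasing[OF t])
    fix s assume "t \<le> s" "s \<le> 0"
    then have s: "s \<in> closed_segment 0 t" by (simp add: closed_segment_eq_real_ivl)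
    have "((\<lambda>s. D s * exp (L * s)) has_real_derivative (D' s + L * D s) * exp (L * s)) (at s)"
      by (rule derivative_eq_intros deriv[OF s] refl | simp add: algebra_simps)+
    moreover have "0 \<le> (D' s + L * D s) * exp (L * s)"
      using bound[OF s] by (intro mult_nonneg_nonneg) auto
    ultimately show "\<exists>y. ((\<lambda>s. D s * exp (L * s)) has_real_derivative y) (at s) \<and> 0 \<le> y"
      by blast
  qed
  with assms(3,4) show ?thesis by (simp add: mult_le_0_iff)
qed

text \<open>
  On a compact time set no two vortices come arbitrarily close: each of the finitely many
  functions \<^term>\<open>\<lambda>s. 1 - X s i \<bullet> X s j\<close> is continuous and, by strictness in the
  Cauchy--Schwarz inequality for distinct unit vectors, positive.
\<close>
lemma vortex_solution_separated:
  assumes X: "vortex_solution_on J M lam X" and S: "compact S" "S \<subseteq> J"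
  obtains c where "0 < c" "\<And>s i j. s \<in> S \<Longrightarrow> i < M \<Longrightarrow> j < M \<Longrightarrow> i \<noteq> j \<Longrightarrow> c \<le> 1 - X s i \<bullet> X s j"
proof -
  have cont: "continuous_on S (\<lambda>s. X s i)" if "i < M" for i
    using X that S(2) unfolding vortex_solution_on_def
    by (meson continuous_on_subset continuous_on_vector_derivative)
  have pos: "X s i \<bullet> X s j < 1" if "s \<in> S" "i < M" "j < M" "i \<noteq> j" for s i j
  proof -
    have "norm (X s i) = 1" "norm (X s j) = 1" "X s i \<noteq> X s j"
      using X S that by (auto simp: vortex_solution_on_def phase_space_def)
    then show ?thesis
      using norm_cauchy_schwarz[of "X s i" "X s j"] norm_cauchy_schwarz_eq[of "X s i" "X s j"]
      by fastforce
  qed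
  define Q where "Q = {(i, j). i < M \<and> j < M \<and> i \<noteq> j}"
  have "finite Q"
    by (rule finite_subset[of _ "{..<M} \<times> {..<M}"]) (auto simp: Q_def)
  have "\<exists>c>0. \<forall>s\<in>S. c \<le> 1 - X s (fst p) \<bullet> X s (snd p)" if "p \<in> Q" for p
  proof (cases "S = {}")
    case True
    then show ?thesis by (auto intro: exI[of _ 1])
  next
    case False
    have "continuous_on S (\<lambda>s. 1 - X s (fst p) \<bullet> X s (snd p))"
      using that by (intro continuous_intros cont) (auto simp: Q_def)
    from continuous_attains_inf[OF S(1) False this] obtain s0 where
      "s0 \<in> S" "\<forall>s\<in>S. 1 - X s0 (fst p) \<bullet> X s0 (snd p) \<le> 1 - X s (fst p) \<bullet> X s (snd p)"
      by blast
    then show ?thesis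
      using pos[of s0 "fst p" "snd p"] that
      by (intro exI[of _ "1 - X s0 (fst p) \<bullet> X s0 (snd p)"]) (auto simp: Q_def)
  qed
  then obtain f where f: "\<And>p. p \<in> Q \<Longrightarrow> 0 < f p \<and> (\<forall>s\<in>S. f p \<le> 1 - X s (fst p) \<bullet> X s (snd p))"
    by metis
  show thesis
  proof
    \<comment> \<open>Inserting 1 covers the case of fewer than two vortices, where there are no pairs.\<close>
    show "0 < Min (insert 1 (f ` Q))"
      using f \<open>finite Q\<close> by (subst Min_gr_iff) auto
    fix s i j assume "s \<in> S" "i < M" "j < M" "i \<noteq> j"
    then have "Min (insert 1 (f ` Q)) \<le> f (i, j)"
      using \<open>finite Q\<close> by (intro Min_le) (auto simp: Q_def)
    also have "\<dots> \<le> 1 - X s i \<bullet> X s j"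
      using f[of "(i, j)"] \<open>s \<in> S\<close> \<open>i < M\<close> \<open>j < M\<close> \<open>i \<noteq> j\<close> by (auto simp: Q_def)
    finally show "Min (insert 1 (f ` Q)) \<le> 1 - X s i \<bullet> X s j" .
  qed
qed

text \<open>
  Gronwall's inequality for the squared distance of the two solutions. Both are separated on the
  compact segment from \<^term>\<open>0::real\<close> to \<^term>\<open>t\<close>, so the interaction is Lipschitz along
  them with one constant \<^term>\<open>C\<close>.
\<close>
lemma vortex_solution_unique:
  assumes J: "open J" "is_interval J" "0 \<in> J"
    and X: "vortex_solution_on J M lam X" and Y: "vortex_solution_on J M lam Y"
    and init: "\<And>i. i < M \<Longrightarrow> X 0 i = Y 0 i"
    and "t \<in> J" "i < M"
  shows "X t i = Y t i"
proof -
  define S where "S = closed_segment 0 t"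
  have S: "compact S" "S \<subseteq> J"
    using J \<open>t \<in> J\<close> by (auto simp: S_def closed_segment_subset is_interval_convex)
  obtain c1 where c1: "0 < c1"
    "\<And>s i j. s \<in> S \<Longrightarrow> i < M \<Longrightarrow> j < M \<Longrightarrow> i \<noteq> j \<Longrightarrow> c1 \<le> 1 - X s i \<bullet> X s j"
    using vortex_solution_separated[OF X S] by blast
  obtain c2 where c2: "0 < c2"
    "\<And>s i j. s \<in> S \<Longrightarrow> i < M \<Longrightarrow> j < M \<Longrightarrow> i \<noteq> j \<Longrightarrow> c2 \<le> 1 - Y s i \<bullet> Y s j"
    using vortex_solution_separated[OF Y S] by blast
  define c where "c = min c1 c2"
  define C where "C = 1 / c + 1 / c\<^sup>2"
  have "0 < c" using c1 c2 by (simp add: c_def)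
  then have "0 \<le> C" by (simp add: C_def)
  define u where "u = (\<lambda>s i. X s i - Y s i)"
  define v where "v = (\<lambda>s i. vortex_field M lam (X s) i - vortex_field M lam (Y s) i)"
  define D where "D = (\<lambda>s. \<Sum>i<M. u s i \<bullet> u s i)"
  define D' where "D' = (\<lambda>s. \<Sum>i<M. 2 * (u s i \<bullet> v s i))"
  define \<Lambda> where "\<Lambda> = (\<Sum>j<M. \<bar>lam j\<bar>)"
  have D_nonneg: "0 \<le> D s" for s by (simp add: D_def sum_nonneg)
  have u_le: "norm (u s i) \<le> sqrt (D s)" if "i < M" for s i
  proof -
    have "u s i \<bullet> u s i \<le> D s"
      unfolding D_def using that by (intro member_le_sum) auto
    then show ?thesis by (simp add: norm_eq_sqrt_inner)
  qed
  have v_le: "norm (v s i) \<le> 2 * C * \<Lambda> * sqrt (D s)" if s: "s \<in> S" and i: "i < M" for s i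
  proof -
    have unit: "norm (X s k) = 1" "norm (Y s k) = 1" if "k < M" for k
      using X Y S s that by (auto simp: vortex_solution_on_def phase_space_def)
    have "norm (v s i)
        = norm (\<Sum>j<M. lam j *\<^sub>R (interaction (X s j) (X s i) - interaction (Y s j) (Y s i)))"
      using i by (simp add: v_def vortex_field_eq_sum scaleR_diff_right sum_subtractf)
    also have "\<dots> \<le> (\<Sum>j<M. \<bar>lam j\<bar> * (C * (2 * sqrt (D s))))"
    proof (rule sum_norm_le)
      fix j assume "j \<in> {..<M}"
      then have j: "j < M" by simp
      have "norm (interaction (X s j) (X s i) - interaction (Y s j) (Y s i))
            \<le> C * (2 * sqrt (D s))"
      proof (cases "j = i")
        case True
        then show ?thesis using \<open>0 \<le> C\<close> D_nonneg by simp
      next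
        case False
        have "c \<le> 1 - X s i \<bullet> X s j" "c \<le> 1 - Y s i \<bullet> Y s j"
          using c1(2)[OF s i j] c2(2)[OF s i j] False by (auto simp: c_def)
        then have "norm (interaction (X s j) (X s i) - interaction (Y s j) (Y s i))
            \<le> C * (norm (u s j) + norm (u s i))"
          unfolding C_def u_def using \<open>0 < c\<close> unit i j by (intro interaction_lipschitz) auto
        also have "\<dots> \<le> C * (2 * sqrt (D s))"
          using u_le[OF i, of s] u_le[OF j, of s] \<open>0 \<le> C\<close> by (intro mult_left_mono) auto
        finally show ?thesis .
      qed
      then show "norm (lam j *\<^sub>R (interaction (X s j) (X s i) - interaction (Y s j) (Y s i)))
            \<le> \<bar>lam j\<bar> * (C * (2 * sqrt (D s)))"
        by (simp add: mult_left_mono)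
    qed
    also have "\<dots> = 2 * C * \<Lambda> * sqrt (D s)"
      by (simp add: \<Lambda>_def sum_distrib_left sum_distrib_right mult_ac)
    finally show ?thesis .
  qed
  have "D t = 0"
  proof (rule gronwall_zero[where D = D and t = t and D' = D' and L = "4 * real M * C * \<Lambda>"])
    show "D 0 = 0" using init by (simp add: D_def u_def)
    show "0 \<le> D t" by (rule D_nonneg)
  next
    fix s assume "s \<in> closed_segment 0 t"
    then have s: "s \<in> S" "s \<in> J" using S by (auto simp: S_def)
    have du: "((\<lambda>s. u s i) has_vector_derivative v s i) (at s)" if "i < M" for i
      using X Y s that J at_within_open[OF s(2) J(1)]
      by (auto simp: vortex_solution_on_def u_def v_def intro!: derivative_intros)
    have "((\<lambda>s. u s i \<bullet> u s i) has_real_derivative 2 * (u s i \<bullet> v s i)) (at s)"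
      if "i < M" for i
      using bounded_bilinear.has_vector_derivative[OF bounded_bilinear_inner du[OF that] du[OF that]]
      by (simp add: has_real_derivative_iff_has_vector_derivative inner_commute)
    then show "(D has_real_derivative D' s) (at s)"
      unfolding D_def D'_def by (intro DERIV_sum) auto
    have "\<bar>D' s\<bar> \<le> (\<Sum>i<M. 4 * C * \<Lambda> * D s)"
      unfolding D'_def
    proof (rule order_trans[OF sum_abs], rule sum_mono)
      fix i assume "i \<in> {..<M}"
      then have i: "i < M" by simp
      have "\<bar>u s i \<bullet> v s i\<bar> \<le> norm (u s i) * norm (v s i)"
        by (rule Cauchy_Schwarz_ineq2)
      also have "\<dots> \<le> sqrt (D s) * (2 * C * \<Lambda> * sqrt (D s))"
        using u_le[OF i] v_le[OF s(1) i] D_nonneg by (intro mult_mono) auto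
      also have "\<dots> = 2 * C * \<Lambda> * D s"
        using D_nonneg[of s] by (simp add: algebra_simps)
      finally show "\<bar>2 * (u s i \<bullet> v s i)\<bar> \<le> 4 * C * \<Lambda> * D s" by (simp add: abs_mult)
    qed
    then show "\<bar>D' s\<bar> \<le> 4 * real M * C * \<Lambda> * D s" by simp
  qed
  then have "u t i \<bullet> u t i = 0"
    using \<open>i < M\<close> by (simp add: D_def sum_nonneg_eq_0_iff)
  then show ?thesis by (simp add: u_def)
qed

section \<open>Maps preserving the axis and uniformly rotating solutions\<close>

text \<open>
  For \<^term>\<open>a\<close> and \<^term>\<open>b\<close> in \<open>{1, -1}\<close> these are exactly the orthogonal maps that preserve the
  polar axis: longitudes change by \<open>\<psi> \<mapsto> t + a * \<psi>\<close>, and the poles are exchanged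
  when \<open>b = -1\<close>. One family covers the three kinds of symmetry of the configuration: rotations
  (\<open>a = b = 1\<close>), reflections in a meridian plane (\<open>a = -1\<close>, \<open>b = 1\<close>) and rotatory
  reflections exchanging the hemispheres (\<open>a = 1\<close>, \<open>b = -1\<close>).
\<close>
definition axial :: "real \<Rightarrow> real \<Rightarrow> real \<Rightarrow> real^3^3" where
  "axial a b t = vector [vector [cos t, - (a * sin t), 0], vector [sin t, a * cos t, 0], vector [0, 0, b]]"

lemma axial_mult_vec:
  "axial a b t *v v = vector [cos t * v $ 1 - a * sin t * v $ 2, sin t * v $ 1 + a * cos t * v $ 2, b * v $ 3]"
  by (simp add: axial_def vec_eq_iff forall_3 matrix_vector_mult_def sum_3)

lemma det_axial: "det (axial a b t) = a * b"
proof -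
  have "det (axial a b t) = a * b * (cos t * cos t) + a * b * (sin t * sin t)"
    unfolding det_3 axial_def by (simp add: algebra_simps)
  also have "\<dots> = a * b * ((cos t)\<^sup>2 + (sin t)\<^sup>2)"
    by (simp only: power2_eq_square distrib_left)
  finally show ?thesis by simp
qed

lemma orthogonal_matrix_axial:
  assumes "a = 1 \<or> a = - 1" "b = 1 \<or> b = - 1"
  shows "orthogonal_matrix (axial a b t)"
proof -
  have "cos t * cos t + sin t * sin t = 1" "sin t * sin t + cos t * cos t = 1"
    by (simp_all flip: power2_eq_square)
  with assms show ?thesis
    unfolding orthogonal_matrix axial_def
    by (auto simp: vec_eq_iff forall_3 matrix_matrix_mult_def sum_3 transpose_def mat_def)
qed

lemma rotation_matrix_axial: "rotation_matrix (axial 1 1 t)"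
  by (simp add: rotation_matrix_def orthogonal_matrix_axial det_axial)

text \<open>
  Uniform rotation about the polar axis with angular velocity \<^term>\<open>\<omega>\<close> is the flow of the
  infinitesimal rotation \<open>q \<mapsto> \<omega> e\<^sub>3 \<times> q\<close>.
\<close>
lemma has_vector_derivative_axial:
  "((\<lambda>s. axial 1 1 (\<omega> * s) *v v) has_vector_derivative
      \<omega> *\<^sub>R cross3 (vector [0, 0, 1]) (axial 1 1 (\<omega> * t) *v v)) (at t within J)"
proof -
  have eq: "axial 1 1 r *v v
      = cos r *\<^sub>R vector [v $ 1, v $ 2, 0] + sin r *\<^sub>R vector [- (v $ 2), v $ 1, 0] + vector [0, 0, v $ 3]"
    for r by (simp add: axial_mult_vec vec_eq_iff forall_3)
  have "((\<lambda>s. cos (\<omega> * s) *\<^sub>R (vector [v $ 1, v $ 2, 0] :: real^3)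
              + sin (\<omega> * s) *\<^sub>R vector [- (v $ 2), v $ 1, 0] + vector [0, 0, v $ 3])
        has_vector_derivative
          (- \<omega> * sin (\<omega> * t)) *\<^sub>R vector [v $ 1, v $ 2, 0]
          + (\<omega> * cos (\<omega> * t)) *\<^sub>R vector [- (v $ 2), v $ 1, 0]) (at t within J)"
    by (auto intro!: derivative_eq_intros simp: mult.commute)
  moreover have "(- \<omega> * sin (\<omega> * t)) *\<^sub>R vector [v $ 1, v $ 2, 0]
          + (\<omega> * cos (\<omega> * t)) *\<^sub>R vector [- (v $ 2), v $ 1, 0]
        = \<omega> *\<^sub>R cross3 (vector [0, 0, 1]) (axial 1 1 (\<omega> * t) *v v)"
    by (simp add: axial_mult_vec vec_eq_iff forall_3 cross3_def algebra_simps)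
  ultimately show ?thesis unfolding eq by simp
qed

lemma vortex_field_rotation:
  assumes "rotation_matrix A" "i < M"
  shows "vortex_field M lam (\<lambda>j. A *v x j) i = A *v vortex_field M lam x i"
  using assms
  by (simp add: vortex_field_eq_sum interaction_orthogonal rotation_matrix_def matrix_vector_mult_scaleR
      matrix_vector_mul_linear linear_sum)

lemma phase_space_orthogonal:
  assumes "orthogonal_matrix A" "x \<in> phase_space M"
  shows "(\<lambda>i. A *v x i) \<in> phase_space M"
proof -
  have "orthogonal_transformation ((*v) A)"
    using assms(1) by (simp add: orthogonal_transformation_matrix matrix_vector_mul_linear)
  then have "inj ((*v) A)" "\<And>v. norm (A *v v) = norm v"
    by (auto simp: orthogonal_transformation_inj orthogonal_transformation_norm)
  with assms(2) show ?thesis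
    by (auto simp: phase_space_def inj_eq)
qed

text \<open>
  If the velocities at \<^term>\<open>xe\<close> are those of an infinitesimal rotation, then rotating
  \<^term>\<open>xe\<close> uniformly keeps this true, because the vortex field commutes with rotations. The
  rotating configuration is thus a global solution, and uniqueness makes every other solution
  through \<^term>\<open>xe\<close> a restriction of it.
\<close>
lemma relative_equilibrium_if_rigid_field:
  assumes xe: "xe \<in> phase_space M"
    and field: "\<And>i. i < M \<Longrightarrow> vortex_field M lam xe i = \<omega> *\<^sub>R cross3 (vector [0, 0, 1]) (xe i)"
  shows "relative_equilibrium M lam xe"
proof -
  define Z where "Z = (\<lambda>t i. axial 1 1 (\<omega> * t) *v xe i)"
  have Z0: "Z 0 i = xe i" for i
    by (simp add: Z_def axial_mult_vec vec_eq_iff forall_3)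
  have fieldZ: "vortex_field M lam (Z t) i = \<omega> *\<^sub>R cross3 (vector [0, 0, 1]) (Z t i)"
    if "i < M" for t i
  proof -
    have "axial 1 1 (\<omega> * t) *v vector [0, 0, 1] = vector [0, 0, 1]"
      by (simp add: axial_mult_vec)
    then show ?thesis
      using that cross_rotation_matrix[OF rotation_matrix_axial, of "\<omega> * t" "vector [0, 0, 1]" "xe i"]
      by (simp add: Z_def vortex_field_rotation[OF rotation_matrix_axial] field
          matrix_vector_mult_scaleR)
  qed
  have Z_phase: "Z t \<in> phase_space M" for t
    unfolding Z_def using phase_space_orthogonal[OF _ xe] by (simp add: orthogonal_matrix_axial)
  have Z: "vortex_solution_on J M lam Z" for J
    unfolding vortex_solution_on_def
  proof (intro ballI conjI allI impI Z_phase)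
    fix t i assume "i < M"
    show "((\<lambda>s. Z s i) has_vector_derivative vortex_field M lam (Z t) i) (at t within J)"
      unfolding fieldZ[OF \<open>i < M\<close>] unfolding Z_def by (rule has_vector_derivative_axial)
  qed
  show ?thesis
    unfolding relative_equilibrium_def
  proof (intro conjI allI impI ballI, rule xe)
    show "\<exists>X. vortex_solution_on UNIV M lam X \<and> (\<forall>i<M. X 0 i = xe i)"
      using Z Z0 by blast
  next
    fix J :: "real set" and X and t :: real
    assume J: "open J \<and> is_interval J \<and> 0 \<in> J \<and> vortex_solution_on J M lam X \<and> (\<forall>i<M. X 0 i = xe i)"
      and "t \<in> J"
    then have "X t i = Z t i" if "i < M" for i
      using that Z0 vortex_solution_unique[of J M lam X Z t i] Z[of J] by simp
    then show "\<exists>g :: real^3^3. rotation_matrix g \<and> (\<forall>i<M. X t i = g *v xe i)"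
      unfolding Z_def using rotation_matrix_axial by blast
  qed
qed

section \<open>Latitudinal rings of points\<close>

lemma axial_sphere_point:
  assumes "a = 1 \<or> a = - 1"
  shows "axial a 1 t *v sphere_point \<theta> \<psi> = sphere_point \<theta> (t + a * \<psi>)"
    and "axial a (- 1) t *v sphere_point \<theta> \<psi> = sphere_point (pi - \<theta>) (t + a * \<psi>)"
  using assms
  by (auto simp: axial_mult_vec sphere_point_def vec_eq_iff forall_3 sin_add cos_add sin_diff cos_diff
      algebra_simps)

lemma sphere_point_add_periods: "sphere_point \<theta> (\<psi> + 2 * pi * of_int m) = sphere_point \<theta> \<psi>"
proof -
  have "sin (\<psi> + 2 * pi * of_int m) = sin \<psi> \<and> cos (\<psi> + 2 * pi * of_int m) = cos \<psi>"
    using sin_cos_eq_iff by blast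
  then show ?thesis by (simp add: sphere_point_def)
qed

lemma sphere_point_eqD:
  assumes "sphere_point \<theta> \<psi> = sphere_point \<theta>' \<psi>'" "0 < \<theta>" "\<theta> < pi" "0 < \<theta>'" "\<theta>' < pi"
  shows "\<theta> = \<theta>'" "\<exists>m::int. \<psi> = \<psi>' + 2 * pi * m"
proof -
  have eq: "sin \<theta> * cos \<psi> = sin \<theta>' * cos \<psi>'" "sin \<theta> * sin \<psi> = sin \<theta>' * sin \<psi>'" "cos \<theta> = cos \<theta>'"
    using assms(1) by (auto simp: sphere_point_def vec_eq_iff forall_3)
  show "\<theta> = \<theta>'" using eq(3) assms by (metis cos_inj_pi less_imp_le)
  moreover have "sin \<theta> > 0" using assms sin_gt_zero by blast
  ultimately have "sin \<psi> = sin \<psi>' \<and> cos \<psi> = cos \<psi>'" using eq by simp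
  then show "\<exists>m::int. \<psi> = \<psi>' + 2 * pi * m" using sin_cos_eq_iff by blast
qed

lemma norm_sphere_point: "norm (sphere_point \<theta> \<psi>) = 1"
proof -
  have "(sin \<theta> * cos \<psi>)\<^sup>2 + (sin \<theta> * sin \<psi>)\<^sup>2 + (cos \<theta>)\<^sup>2
      = (sin \<theta>)\<^sup>2 * ((cos \<psi>)\<^sup>2 + (sin \<psi>)\<^sup>2) + (cos \<theta>)\<^sup>2"
    by (simp only: power_mult_distrib distrib_left)
  also have "\<dots> = 1" by simp
  finally have "(sin \<theta> * cos \<psi>)\<^sup>2 + (sin \<theta> * sin \<psi>)\<^sup>2 + (cos \<theta>)\<^sup>2 = 1" .
  then have "sphere_point \<theta> \<psi> \<bullet> sphere_point \<theta> \<psi> = 1"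
    by (simp add: sphere_point_def inner_vec_def sum_3 power2_eq_square)
  then show ?thesis by (simp add: norm_eq_sqrt_inner)
qed

text \<open>
  Indexing by all integers lists every vertex infinitely often, but makes the invariance of the
  ring under shifts and reversals of the index evident.
\<close>
definition ring_points :: "nat \<Rightarrow> real \<Rightarrow> real \<Rightarrow> (real^3) set" where
  "ring_points N \<theta> \<phi> = range (\<lambda>k::int. sphere_point \<theta> (\<phi> + 2 * pi * of_int k / real N))"

lemma ring_points_eq_latitudinal_ngon:
  assumes "0 < N"
  shows "ring_points N \<theta> \<phi> = latitudinal_ngon N \<theta> \<phi> ` {..<N}"
proof
  show "latitudinal_ngon N \<theta> \<phi> ` {..<N} \<subseteq> ring_points N \<theta> \<phi>"
  proof clarify
    fix k
    have "latitudinal_ngon N \<theta> \<phi> k = sphere_point \<theta> (\<phi> + 2 * pi * of_int (int k) / real N)"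
      by (simp add: latitudinal_ngon_def)
    then show "latitudinal_ngon N \<theta> \<phi> k \<in> ring_points N \<theta> \<phi>"
      unfolding ring_points_def by blast
  qed
  show "ring_points N \<theta> \<phi> \<subseteq> latitudinal_ngon N \<theta> \<phi> ` {..<N}"
  proof
    fix q assume "q \<in> ring_points N \<theta> \<phi>"
    then obtain k :: int where q: "q = sphere_point \<theta> (\<phi> + 2 * pi * of_int k / real N)"
      by (auto simp: ring_points_def)
    define r where "r = nat (k mod int N)"
    have "k = int N * (k div int N) + int r"
      using assms by (simp add: r_def)
    then have "real_of_int k = real N * of_int (k div int N) + real r"
      by (metis of_int_add of_int_mult of_int_of_nat_eq)
    then have "\<phi> + 2 * pi * of_int k / real N
        = (\<phi> + 2 * pi * real r / real N) + 2 * pi * of_int (k div int N)"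
      using assms by (simp add: field_simps)
    then have "q = latitudinal_ngon N \<theta> \<phi> r"
      unfolding q latitudinal_ngon_def by (simp only: sphere_point_add_periods)
    moreover have "r < N" using assms by (simp add: r_def nat_less_iff)
    ultimately show "q \<in> latitudinal_ngon N \<theta> \<phi> ` {..<N}" by blast
  qed
qed

text \<open>
  The image of a ring is the ring at the same or at the opposite latitude as soon as one vertex
  is sent to a vertex, here to the one with index \<^term>\<open>m\<close>.
\<close>
lemma axial_image_ring_points:
  assumes a: "a = 1 \<or> a = - 1" and b: "b = 1 \<or> b = - 1" and "0 < N"
    and shift: "t + a * \<phi> = \<phi>' + 2 * pi * of_int m / real N"
  shows "(*v) (axial a b t) ` ring_points N \<theta> \<phi> = ring_points N (if b = 1 then \<theta> else pi - \<theta>) \<phi>'"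
proof -
  \<comment> \<open>On indices the map acts as k -> m + s k with s = 1 or s = -1, a bijection of the integers.\<close>
  define s where "s = (if a = 1 then 1 else - 1 :: int)"
  have s: "a = of_int s" "s * s = 1" using a by (auto simp: s_def)
  have angle: "t + a * (\<phi> + 2 * pi * of_int k / real N) = \<phi>' + 2 * pi * of_int (m + s * k) / real N" for k
    using shift by (simp add: s(1) algebra_simps add_divide_distrib)
  have "surj (\<lambda>k. m + s * k)"
  proof (rule surjI)
    show "m + s * (s * (k - m)) = k" for k
      using s(2) by (simp flip: mult.assoc)
  qed
  then have reindex: "range (\<lambda>k. P (m + s * k)) = range P" for P :: "int \<Rightarrow> real^3"
    by (metis (no_types) image_image)
  define P where "P = (\<lambda>k. sphere_point (if b = 1 then \<theta> else pi - \<theta>) (\<phi>' + 2 * pi * of_int k / real N))"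
  have "axial a b t *v sphere_point \<theta> (\<phi> + 2 * pi * of_int k / real N) = P (m + s * k)" for k
    using b by (auto simp: P_def axial_sphere_point[OF a] angle)
  then have "(*v) (axial a b t) ` ring_points N \<theta> \<phi> = range (\<lambda>k. P (m + s * k))"
    by (simp add: ring_points_def image_image)
  also have "\<dots> = ring_points N (if b = 1 then \<theta> else pi - \<theta>) \<phi>'"
    unfolding reindex by (simp add: ring_points_def P_def)
  finally show ?thesis .
qed

section \<open>Symmetries of the two-ring field\<close>

definition ring_field :: "(real^3) set \<Rightarrow> real^3 \<Rightarrow> real^3" where
  "ring_field P q = (\<Sum>p\<in>P. interaction p q)"

lemma ring_field_orthogonal:
  assumes "orthogonal_matrix A"
  shows "ring_field ((*v) A ` P) (A *v q) = det A *\<^sub>R (A *v ring_field P q)"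
proof -
  have "inj ((*v) A)"
    using assms by (simp add: orthogonal_transformation_inj orthogonal_transformation_matrix
        matrix_vector_mul_linear)
  then have "ring_field ((*v) A ` P) (A *v q) = (\<Sum>p\<in>P. interaction (A *v p) (A *v q))"
    by (simp add: ring_field_def sum.reindex inj_on_subset)
  also have "\<dots> = det A *\<^sub>R (A *v ring_field P q)"
    by (simp add: ring_field_def interaction_orthogonal[OF assms] scaleR_sum_right
        linear_sum matrix_vector_mul_linear)
  finally show ?thesis .
qed

text \<open>
  The velocity induced at the position \<^term>\<open>q\<close> by the two rings and by polar vortices of
  strength \<^term>\<open>\<mu>\<close> and \<^term>\<open>- \<mu>\<close>; the value \<open>\<mu> = 0\<close> describes a configuration without
  polar vortices.
\<close>
definition two_ring_field :: "nat \<Rightarrow> real \<Rightarrow> real \<Rightarrow> real \<Rightarrow> real \<Rightarrow> real^3 \<Rightarrow> real^3" where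
  "two_ring_field N \<theta> \<phi> \<delta> \<mu> q =
     ring_field (ring_points N \<theta> \<phi>) q - ring_field (ring_points N (pi - \<theta>) (\<phi> + \<delta>)) q
     + \<mu> *\<^sub>R (interaction (vector [0, 0, 1]) q - interaction (vector [0, 0, -1]) q)"

text \<open>
  Two signs combine. The interaction picks up the determinant \<^term>\<open>a * b\<close>, and a map that
  exchanges the hemispheres also exchanges positive and negative vortices, which contributes
  another \<^term>\<open>b\<close>. What is left is \<^term>\<open>a\<close>.
\<close>
lemma two_ring_field_axial:
  assumes a: "a = 1 \<or> a = - 1" and b: "b = 1 \<or> b = - 1"
    and upper: "(*v) (axial a b t) ` ring_points N \<theta> \<phi> = (if b = 1 then ring_points N \<theta> \<phi> else ring_points N (pi - \<theta>) (\<phi> + \<delta>))"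
    and lower: "(*v) (axial a b t) ` ring_points N (pi - \<theta>) (\<phi> + \<delta>)
                = (if b = 1 then ring_points N (pi - \<theta>) (\<phi> + \<delta>) else ring_points N \<theta> \<phi>)"
  shows "two_ring_field N \<theta> \<phi> \<delta> \<mu> (axial a b t *v q) = a *\<^sub>R (axial a b t *v two_ring_field N \<theta> \<phi> \<delta> \<mu> q)"
proof -
  let ?A = "axial a b t"
  let ?P = "ring_points N \<theta> \<phi>" and ?Q = "ring_points N (pi - \<theta>) (\<phi> + \<delta>)"
  note orth = orthogonal_matrix_axial[OF a b, of t]
  note P = ring_field_orthogonal[OF orth, of ?P q, unfolded upper det_axial]
  note Q = ring_field_orthogonal[OF orth, of ?Q q, unfolded lower det_axial]
  have pole: "?A *v vector [0, 0, z] = vector [0, 0, b * z]" for z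
    by (simp add: axial_mult_vec)
  have poles: "interaction (vector [0, 0, b * z]) (?A *v q) = (a * b) *\<^sub>R (?A *v interaction (vector [0, 0, z]) q)" for z
    using interaction_orthogonal[OF orth, of "vector [0, 0, z]" q] by (simp add: pole det_axial)
  show ?thesis
    using b P Q poles[of 1] poles[of "- 1"]
    by (auto simp: two_ring_field_def matrix_vector_right_distrib matrix_vector_mult_diff_distrib
        matrix_vector_mult_scaleR scaleR_add_right scaleR_diff_right mult.commute)
qed

text \<open>
  Both offsets satisfy \<open>2 \<delta> \<in> (2 \<pi> / N) \<int>\<close>, and this is the whole reason for the choice of
  \<^term>\<open>\<delta>\<close>. The reflection in the meridian of a vertex of the first ring moves the second ring by
  \<open>-2 \<delta>\<close> in longitude, and the rotatory reflection by \<^term>\<open>\<delta>\<close>, which sends the first ring to the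
  second, sends the second to the first shifted by \<open>2 \<delta>\<close>. In both cases the
  pair of rings is preserved exactly under this condition.
\<close>
lemma two_ring_field_symmetries:
  assumes "0 < N" and offset: "\<delta> = 0 \<or> \<delta> = pi / real N"
  shows two_ring_field_rotate: "two_ring_field N \<theta> \<phi> \<delta> \<mu> (axial 1 1 (2 * pi * of_int k / real N) *v q)
           = axial 1 1 (2 * pi * of_int k / real N) *v two_ring_field N \<theta> \<phi> \<delta> \<mu> q"
    and two_ring_field_reflect: "two_ring_field N \<theta> \<phi> \<delta> \<mu> (axial (- 1) 1 (2 * \<phi>) *v q)
           = - (axial (- 1) 1 (2 * \<phi>) *v two_ring_field N \<theta> \<phi> \<delta> \<mu> q)"
    and two_ring_field_swap: "two_ring_field N \<theta> \<phi> \<delta> \<mu> (axial 1 (- 1) \<delta> *v q)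
           = axial 1 (- 1) \<delta> *v two_ring_field N \<theta> \<phi> \<delta> \<mu> q"
proof -
  obtain e :: int where e: "2 * \<delta> = 2 * pi * of_int e / real N"
    using offset by (metis mult_zero_right of_int_0 of_int_1 mult.right_neutral div_0 times_divide_eq_right)
  note image = axial_image_ring_points[OF _ _ \<open>0 < N\<close>]
  show "two_ring_field N \<theta> \<phi> \<delta> \<mu> (axial 1 1 (2 * pi * of_int k / real N) *v q)
           = axial 1 1 (2 * pi * of_int k / real N) *v two_ring_field N \<theta> \<phi> \<delta> \<mu> q"
    by (subst two_ring_field_axial) (auto simp: image[where m = k])
  show "two_ring_field N \<theta> \<phi> \<delta> \<mu> (axial (- 1) 1 (2 * \<phi>) *v q)
           = - (axial (- 1) 1 (2 * \<phi>) *v two_ring_field N \<theta> \<phi> \<delta> \<mu> q)"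
    using image[of "- 1" 1 "2 * \<phi>" \<phi> \<phi> 0 \<theta>] 
      image[of "- 1" 1 "2 * \<phi>" "\<phi> + \<delta>" "\<phi> + \<delta>" "- e" "pi - \<theta>"] e
    by (subst two_ring_field_axial) (auto simp: algebra_simps)
  show "two_ring_field N \<theta> \<phi> \<delta> \<mu> (axial 1 (- 1) \<delta> *v q)
           = axial 1 (- 1) \<delta> *v two_ring_field N \<theta> \<phi> \<delta> \<mu> q"
    using image[of 1 "- 1" \<delta> \<phi> "\<phi> + \<delta>" 0 \<theta>] 
      image[of 1 "- 1" \<delta> "\<phi> + \<delta>" \<phi> e "pi - \<theta>"] e
    by (subst two_ring_field_axial) (auto simp: algebra_simps)
qed

text \<open>
  A vector reversed by the reflection in the meridian plane at longitude \<^term>\<open>\<phi>\<close> is normal to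
  that plane, so it points along the parallel through \<^term>\<open>sphere_point \<theta> \<phi>\<close>. Off the poles
  such vectors are multiples of the infinitesimal rotation about the axis.
\<close>
lemma tangential_if_reflection_negates:
  assumes v: "v = - (axial (- 1) 1 (2 * \<phi>) *v v)" and "0 < \<theta>" "\<theta> < pi"
  shows "\<exists>\<omega>. v = \<omega> *\<^sub>R cross3 (vector [0, 0, 1]) (sphere_point \<theta> \<phi>)"
proof -
  have v1: "v $ 1 = - (cos (2 * \<phi>) * v $ 1 + sin (2 * \<phi>) * v $ 2)"
    and v2: "v $ 2 = - (sin (2 * \<phi>) * v $ 1 - cos (2 * \<phi>) * v $ 2)"
    and v3: "v $ 3 = 0"
    using v by (auto simp: axial_mult_vec vec_eq_iff forall_3)
  \<comment> \<open>The horizontal components of v: r along the meridian plane, c normal to it.\<close>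
  define r where "r = cos \<phi> * v $ 1 + sin \<phi> * v $ 2"
  define c where "c = cos \<phi> * v $ 2 - sin \<phi> * v $ 1"
  have "r = - (cos (2 * \<phi> - \<phi>) * v $ 1 + sin (2 * \<phi> - \<phi>) * v $ 2)"
    unfolding sin_diff cos_diff r_def
    by (subst v1, subst v2) (simp add: algebra_simps)
  then have "r = 0" by (simp add: r_def)
  have "sin \<phi> * sin \<phi> + cos \<phi> * cos \<phi> = 1"
    by (simp flip: power2_eq_square)
  then have "v $ 1 = cos \<phi> * r - sin \<phi> * c" "v $ 2 = sin \<phi> * r + cos \<phi> * c"
    unfolding r_def c_def by algebra+
  moreover have "sin \<theta> \<noteq> 0"
    using assms sin_gt_zero[of \<theta>] by auto
  ultimately have "v = (c / sin \<theta>) *\<^sub>R cross3 (vector [0, 0, 1]) (sphere_point \<theta> \<phi>)"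
    using v3 \<open>r = 0\<close> by (simp add: vec_eq_iff forall_3 cross3_def sphere_point_def)
  then show ?thesis ..
qed

text \<open>
  The angular velocity is read off at one vertex, where the reflection in its meridian forces the
  velocity to be tangential to the parallel. Rotations carry the value to the other vertices of
  that ring, and the rotatory reflection carries it to the second ring. Both kinds of map commute
  with the infinitesimal rotation, so the angular velocity stays the same.
\<close>
lemma two_ring_field_rigid:
  assumes "0 < N" "0 < \<theta>" "\<theta> < pi" and offset: "\<delta> = 0 \<or> \<delta> = pi / real N"
  obtains \<omega> where "\<And>q. q \<in> ring_points N \<theta> \<phi> \<union> ring_points N (pi - \<theta>) (\<phi> + \<delta>) \<Longrightarrow>
      two_ring_field N \<theta> \<phi> \<delta> \<mu> q = \<omega> *\<^sub>R cross3 (vector [0, 0, 1]) q"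
proof -
  let ?F = "two_ring_field N \<theta> \<phi> \<delta> \<mu>" and ?n = "vector [0, 0, 1] :: real^3"
  note rotate = two_ring_field_rotate[OF \<open>0 < N\<close> offset]
    and reflect = two_ring_field_reflect[OF \<open>0 < N\<close> offset]
    and swap = two_ring_field_swap[OF \<open>0 < N\<close> offset]
  have "axial (- 1) 1 (2 * \<phi>) *v sphere_point \<theta> \<phi> = sphere_point \<theta> \<phi>"
    by (simp add: axial_sphere_point)
  then obtain \<omega> where \<omega>: "?F (sphere_point \<theta> \<phi>) = \<omega> *\<^sub>R cross3 ?n (sphere_point \<theta> \<phi>)"
    using tangential_if_reflection_negates[of "?F (sphere_point \<theta> \<phi>)" \<phi> \<theta>] reflect assms by metis
  have transport: "axial 1 b t *v (\<omega> *\<^sub>R cross3 ?n q) = \<omega> *\<^sub>R cross3 ?n (axial 1 b t *v q)" for b t q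
    by (simp add: axial_mult_vec cross3_def vec_eq_iff forall_3 algebra_simps)
  have upper: "?F q = \<omega> *\<^sub>R cross3 ?n q" if q: "q \<in> ring_points N \<theta> \<phi>" for q
  proof -
    obtain k :: int where "q = sphere_point \<theta> (\<phi> + 2 * pi * of_int k / real N)"
      using q by (auto simp: ring_points_def)
    then have "q = axial 1 1 (2 * pi * of_int k / real N) *v sphere_point \<theta> \<phi>"
      by (simp add: axial_sphere_point add.commute)
    then show ?thesis by (simp only: rotate \<omega> transport)
  qed
  have "?F q = \<omega> *\<^sub>R cross3 ?n q" if q: "q \<in> ring_points N (pi - \<theta>) (\<phi> + \<delta>)" for q
  proof -
    have "(*v) (axial 1 (- 1) \<delta>) ` ring_points N \<theta> \<phi> = ring_points N (pi - \<theta>) (\<phi> + \<delta>)"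
      using axial_image_ring_points[of 1 "- 1" N \<delta> \<phi> "\<phi> + \<delta>" 0 \<theta>] \<open>0 < N\<close> by simp
    then obtain p where "p \<in> ring_points N \<theta> \<phi>" "q = axial 1 (- 1) \<delta> *v p"
      using q by blast
    then show ?thesis by (simp only: swap upper transport)
  qed
  with upper that show thesis by blast
qed

text \<open>
  The velocity at the North pole is fixed by a rotation of order \<open>N \<ge> 2\<close> about the axis, so it is
  vertical, and it is reversed by a reflection fixing the axis, so its vertical component vanishes.
\<close>
lemma two_ring_field_poles:
  assumes "2 \<le> N" and offset: "\<delta> = 0 \<or> \<delta> = pi / real N"
  shows "two_ring_field N \<theta> \<phi> \<delta> \<mu> (vector [0, 0, 1]) = 0"
    and "two_ring_field N \<theta> \<phi> \<delta> \<mu> (vector [0, 0, - 1]) = 0"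
proof -
  let ?F = "two_ring_field N \<theta> \<phi> \<delta> \<mu>"
  have "0 < N" using assms by simp
  note rotate = two_ring_field_rotate[OF \<open>0 < N\<close> offset]
    and reflect = two_ring_field_reflect[OF \<open>0 < N\<close> offset]
    and swap = two_ring_field_swap[OF \<open>0 < N\<close> offset]
  define v where "v = ?F (vector [0, 0, 1])"
  define c s where "c = cos (2 * pi / real N)" and "s = sin (2 * pi / real N)"
  have "v = - (axial (- 1) 1 (2 * \<phi>) *v v)"
    using reflect[of \<theta> \<phi> \<mu> "vector [0, 0, 1]"] by (simp add: v_def axial_mult_vec)
  then have v3: "v $ 3 = 0"
    by (auto simp: axial_mult_vec vec_eq_iff forall_3)
  have "v = axial 1 1 (2 * pi / real N) *v v"
    using rotate[of \<theta> \<phi> \<mu> 1 "vector [0, 0, 1]"] by (simp add: v_def axial_mult_vec)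
  then have v1: "v $ 1 = c * v $ 1 - s * v $ 2" and v2: "v $ 2 = s * v $ 1 + c * v $ 2"
    by (auto simp: axial_mult_vec vec_eq_iff forall_3 c_def s_def)
  have cs: "c * c + s * s = 1" by (simp add: c_def s_def flip: power2_eq_square)
  have "cos (2 * pi / real N) < cos 0"
    using assms by (intro cos_monotone_0_pi) (auto simp: field_simps)
  then have "1 - c \<noteq> 0" by (simp add: c_def)
  \<comment> \<open>The determinant of the linear system v1, v2 is (1 - c)^2 + s^2 = 2 (1 - c).\<close>
  have "2 * (1 - c) * v $ 1 = 0" using v1 v2 cs by algebra
  moreover have "2 * (1 - c) * v $ 2 = 0" using v1 v2 cs by algebra
  ultimately have "v = 0" using v3 \<open>1 - c \<noteq> 0\<close> by (simp add: vec_eq_iff forall_3)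
  then show north: "?F (vector [0, 0, 1]) = 0" by (simp add: v_def)
  show "?F (vector [0, 0, - 1]) = 0"
    using swap[of \<theta> \<phi> \<mu> "vector [0, 0, 1]"] north by (simp add: axial_mult_vec)
qed

section \<open>The two-ring configuration\<close>

lemma latitudinal_ngon_eqD:
  assumes "latitudinal_ngon N \<theta> \<phi> k = latitudinal_ngon N \<theta>' \<phi>' k'"
    and "0 < \<theta>" "\<theta> < pi" "0 < \<theta>'" "\<theta>' < pi" "0 < N"
  shows "\<theta> = \<theta>'" "\<exists>m::int. real N * (\<phi> - \<phi>') = 2 * pi * (real k' - real k + real N * m)"
proof -
  note eq = sphere_point_eqD[OF assms(1)[unfolded latitudinal_ngon_def] assms(2-5)]
  show "\<theta> = \<theta>'" by (rule eq(1))
  from eq(2) obtain m :: int where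
    "\<phi> + 2 * pi * real k / real N = \<phi>' + 2 * pi * real k' / real N + 2 * pi * m" by blast
  then have "real N * (\<phi> - \<phi>') = 2 * pi * (real k' - real k + real N * m)"
    using \<open>0 < N\<close> by (simp add: field_simps)
  then show "\<exists>m::int. real N * (\<phi> - \<phi>') = 2 * pi * (real k' - real k + real N * m)" ..
qed

lemma inj_on_latitudinal_ngon:
  assumes "0 < \<theta>" "\<theta> < pi"
  shows "inj_on (latitudinal_ngon N \<theta> \<phi>) {..<N}"
proof (rule inj_onI)
  fix k k' assume k: "k \<in> {..<N}" "k' \<in> {..<N}"
    and eq: "latitudinal_ngon N \<theta> \<phi> k = latitudinal_ngon N \<theta> \<phi> k'"
  then obtain m :: int where "2 * pi * (real k' - real k + real N * m) = 0"
    using latitudinal_ngon_eqD(2)[OF eq] assms by auto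
  then have "real_of_int (int k) = of_int (int k' + int N * m)" by simp
  then have "int k = int k' + int N * m" by (simp only: of_int_eq_iff)
  then have "int k mod int N = int k' mod int N" by simp
  then show "k = k'" using k by simp
qed

text \<open>
  The rings can meet only on the equator. With the offset \<open>\<pi> / N\<close> an equality of longitudes would
  equate an even multiple of \<open>\<pi> / N\<close> with an odd one.
\<close>
lemma latitudinal_ngons_disjoint:
  assumes "0 < \<theta>" "\<theta> < pi" "0 < N"
    and offset: "(\<delta> = 0 \<and> \<theta> \<noteq> pi / 2) \<or> \<delta> = pi / real N"
  shows "latitudinal_ngon N \<theta> \<phi> k \<noteq> latitudinal_ngon N (pi - \<theta>) (\<phi> + \<delta>) k'"
proof
  assume eq: "latitudinal_ngon N \<theta> \<phi> k = latitudinal_ngon N (pi - \<theta>) (\<phi> + \<delta>) k'"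
  note D = latitudinal_ngon_eqD[OF eq]
  have "\<theta> = pi / 2" using D(1) assms by simp
  with offset have \<delta>: "real N * \<delta> = pi" using \<open>0 < N\<close> by simp
  obtain m :: int where "real N * (\<phi> - (\<phi> + \<delta>)) = 2 * pi * (real k' - real k + real N * m)"
    using D(2) assms by auto
  with \<delta> have "pi * (2 * (real k' - real k + real N * m) + 1) = 0"
    by (simp add: algebra_simps)
  then have "real_of_int (2 * (int k' - int k + int N * m) + 1) = 0" by simp
  then have "2 * (int k' - int k + int N * m) + 1 = 0" by (simp only: of_int_eq_0_iff)
  then show False by presburger
qed

lemma two_ring_config_in_phase_space:
  assumes "2 \<le> N" "k_p \<in> {0, 2}" "0 < \<theta>" "\<theta> < pi"
    and offset: "(\<delta> = 0 \<and> \<theta> \<noteq> pi / 2) \<or> \<delta> = pi / real N"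
  shows "two_ring_config N \<theta> \<phi> \<delta> \<in> phase_space (2 * N + k_p)"
proof -
  let ?x = "two_ring_config N \<theta> \<phi> \<delta>"
  have pole: "norm (vector [0, 0, z] :: real^3) = \<bar>z\<bar>" for z
    by (simp add: norm_eq_sqrt_inner inner_vec_def sum_3)
  have unit: "norm (?x i) = 1" for i
    by (auto simp: two_ring_config_def latitudinal_ngon_def norm_sphere_point pole)
  \<comment> \<open>The third coordinate tells the poles from ring vortices and from each other.\<close>
  have "cos \<theta> < cos 0" using assms by (intro cos_monotone_0_pi) auto
  moreover have "cos pi < cos \<theta>" using assms by (intro cos_monotone_0_pi) auto
  ultimately have c: "cos \<theta> < 1" "- 1 < cos \<theta>" by simp_all
  have height: "?x i $ 3 = cos \<theta> \<or> ?x i $ 3 = - cos \<theta>" if "i < 2 * N" for i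
    using that by (auto simp: two_ring_config_def latitudinal_ngon_def sphere_point_def)
  have ne: "?x i \<noteq> ?x j" if "i < j" "j < 2 * N + k_p" for i j
  proof (cases "j < 2 * N")
    case False
    then have "j = 2 * N \<or> j = 2 * N + 1" "i < 2 * N \<or> i = 2 * N \<and> j = 2 * N + 1"
      using that assms(2) by auto
    then have "?x i $ 3 \<noteq> ?x j $ 3"
      using height[of i] c by (auto simp: two_ring_config_def)
    then show ?thesis by auto
  next
    case True
    have "0 < N" using assms by simp
    consider "j < N" | "i < N" "N \<le> j" | "N \<le> i" by linarith
    then show ?thesis
    proof cases
      case 1
      then show ?thesis
        using that inj_on_latitudinal_ngon[of \<theta> N \<phi>] assms
        by (auto simp: two_ring_config_def inj_on_def)
    next
      case 2
      then show ?thesis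
        using True latitudinal_ngons_disjoint[OF assms(3,4) \<open>0 < N\<close> offset]
        by (auto simp: two_ring_config_def)
    next
      case 3
      then have "i - N \<in> {..<N}" "j - N \<in> {..<N}" "i - N \<noteq> j - N"
        using True that by auto
      then have "latitudinal_ngon N (pi - \<theta>) (\<phi> + \<delta>) (i - N) \<noteq> latitudinal_ngon N (pi - \<theta>) (\<phi> + \<delta>) (j - N)"
        using inj_on_latitudinal_ngon[of "pi - \<theta>" N "\<phi> + \<delta>"] assms by (auto simp: inj_on_def)
      then show ?thesis using 3 True that by (simp add: two_ring_config_def)
    qed
  qed
  have "?x i \<noteq> ?x j" if "i \<noteq> j" "i < 2 * N + k_p" "j < 2 * N + k_p" for i j
    using that ne[of i j] ne[of j i] by (cases "i < j") auto
  then show ?thesis by (simp add: phase_space_def unit)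
qed

lemma vortex_field_two_ring_config:
  assumes "0 < N" "k_p \<in> {0, 2}" "0 < \<theta>" "\<theta> < pi" "k_p = 2 \<longrightarrow> lam_s = - lam_n" and i: "i < 2 * N + k_p"
  shows "vortex_field (2 * N + k_p) (two_ring_vorticity N lam_n lam_s) (two_ring_config N \<theta> \<phi> \<delta>) i
     = two_ring_field N \<theta> \<phi> \<delta> (if k_p = 2 then lam_n else 0) (two_ring_config N \<theta> \<phi> \<delta> i)"
proof -
  let ?x = "two_ring_config N \<theta> \<phi> \<delta>"
  define q where "q = ?x i"
  define f where "f = (\<lambda>j. two_ring_vorticity N lam_n lam_s j *\<^sub>R interaction (?x j) q)"
  have upper: "sum f {..<N} = ring_field (ring_points N \<theta> \<phi>) q"
    unfolding ring_field_def ring_points_eq_latitudinal_ngon[OF \<open>0 < N\<close>]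
    using assms by (simp add: sum.reindex inj_on_latitudinal_ngon f_def two_ring_vorticity_def two_ring_config_def)
  have "sum f {N..<2 * N} = (\<Sum>k<N. f (k + N))"
    using sum.shift_bounds_nat_ivl[of f 0 N N] by (simp add: lessThan_atLeast0 mult_2)
  also have "\<dots> = - ring_field (ring_points N (pi - \<theta>) (\<phi> + \<delta>)) q"
    unfolding ring_field_def ring_points_eq_latitudinal_ngon[OF \<open>0 < N\<close>]
    using assms by (simp add: sum.reindex inj_on_latitudinal_ngon f_def two_ring_vorticity_def
        two_ring_config_def sum_negf)
  finally have lower: "sum f {N..<2 * N} = - ring_field (ring_points N (pi - \<theta>) (\<phi> + \<delta>)) q" .
  have "sum f {..<2 * N} = sum f {..<N} + sum f {N..<2 * N}"
    by (simp add: lessThan_atLeast0 sum.atLeastLessThan_concat)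
  with upper lower have rings: "sum f {..<2 * N}
      = ring_field (ring_points N \<theta> \<phi>) q - ring_field (ring_points N (pi - \<theta>) (\<phi> + \<delta>)) q" by simp
  have "vortex_field (2 * N + k_p) (two_ring_vorticity N lam_n lam_s) ?x i = sum f {..<2 * N + k_p}"
    using i by (simp add: vortex_field_eq_sum f_def q_def)
  also have "\<dots> = two_ring_field N \<theta> \<phi> \<delta> (if k_p = 2 then lam_n else 0) q"
  proof (cases "k_p = 2")
    case True
    have "f (2 * N) = lam_n *\<^sub>R interaction (vector [0, 0, 1]) q"
      "f (Suc (2 * N)) = - (lam_n *\<^sub>R interaction (vector [0, 0, -1]) q)"
      using assms True by (auto simp: f_def two_ring_vorticity_def two_ring_config_def)
    then show ?thesis
      using True rings by (simp add: two_ring_field_def scaleR_diff_right)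
  next
    case False
    then show ?thesis using assms(2) rings by (simp add: two_ring_field_def)
  qed
  finally show ?thesis by (simp add: q_def)
qed

theorem theorem3p10:
  fixes N k_p :: nat and \<theta> \<phi> \<delta> lam_n lam_s :: real
  assumes "N \<ge> 2"
    and "k_p \<in> {0, 2}"
    and "0 < \<theta>" "\<theta> < pi"
    and "k_p = 2 \<longrightarrow> lam_s = - lam_n"
    and "(\<delta> = 0 \<and> \<theta> \<noteq> pi / 2) \<or> \<delta> = pi / real N"
  shows "relative_equilibrium (2 * N + k_p) (two_ring_vorticity N lam_n lam_s)
           (two_ring_config N \<theta> \<phi> \<delta>)"
proof -
  let ?x = "two_ring_config N \<theta> \<phi> \<delta>"
  let ?F = "two_ring_field N \<theta> \<phi> \<delta> (if k_p = 2 then lam_n else 0)"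
  have "0 < N" and offset: "\<delta> = 0 \<or> \<delta> = pi / real N" using assms by auto
  obtain \<omega> where \<omega>: "\<And>q. q \<in> ring_points N \<theta> \<phi> \<union> ring_points N (pi - \<theta>) (\<phi> + \<delta>) \<Longrightarrow>
      ?F q = \<omega> *\<^sub>R cross3 (vector [0, 0, 1]) q"
    using two_ring_field_rigid[OF \<open>0 < N\<close> assms(3,4) offset] by blast
  show ?thesis
  proof (rule relative_equilibrium_if_rigid_field[where \<omega> = \<omega>])
    show "?x \<in> phase_space (2 * N + k_p)"
      using assms by (intro two_ring_config_in_phase_space) auto
    fix i assume i: "i < 2 * N + k_p"
    have "?F (?x i) = \<omega> *\<^sub>R cross3 (vector [0, 0, 1]) (?x i)"
    proof (cases "i < 2 * N")
      case True
      then have "?x i \<in> ring_points N \<theta> \<phi> \<union> ring_points N (pi - \<theta>) (\<phi> + \<delta>)"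
        by (auto simp: two_ring_config_def ring_points_eq_latitudinal_ngon[OF \<open>0 < N\<close>])
      then show ?thesis by (rule \<omega>)
    next
      case False
      have "cross3 (vector [0, 0, 1]) (vector [0, 0, z]) = 0" for z
        by (simp add: cross3_def vec_eq_iff forall_3)
      then show ?thesis
        using False by (simp add: two_ring_config_def two_ring_field_poles[OF \<open>N \<ge> 2\<close> offset])
    qed
    then show "vortex_field (2 * N + k_p) (two_ring_vorticity N lam_n lam_s) ?x i
        = \<omega> *\<^sub>R cross3 (vector [0, 0, 1]) (?x i)"
      using vortex_field_two_ring_config[OF \<open>0 < N\<close> assms(2-5) i] by simp
  qed
qed

end
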